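(* Fix a sensor $i\in\{1,\dots,n\}$ and suppose $\lim_{a\to\infty}f_i(a)=\infty$. Let $\Gamma_i$ be the set of all $\gamma_i\in\mathbb{R}_{\geq 0}$ such that $$\alpha_i\gamma_i\frac{(n-1)^2}{n^2}\eta'_i(0)+f'_i(0)<0\quad\text{and}\quad\alpha_i\gamma_i\frac{(n-1)^2}{n^2}\eta''_i(a)+f''_i(a)>0\ \text{ for all }a\in\mathbb{R}_{\geq 0}.$$ For $\gamma_i\in\Gamma_i$ let $a_i^*(\gamma_i)\in\mathbb{R}_{\geq 0}$ be the equilibrium effort of sensor $i$, i.e. the (unique) solution of $$\alpha_i\gamma_i\left(\frac{n-1}{n}\right)^2\eta'_i(a_i^*(\gamma_i))+f'_i(a_i^*(\gamma_i))=0.$$ Then $a_i^*(\gamma_i)$ is an increasing function of $\gamma_i$ on $\Gamma_i$.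
   Context: Here $n$ is the number of sensors, $\alpha_i\in\mathbb{R}_{\geq 0}$ is a constant (value-of-compensation of sensor $i$), $\eta_i:\mathbb{R}_{\geq 0}\to\mathbb{R}_{\geq 0}$ (measurement noise variance as a function of effort) is twice continuously differentiable and strictly decreasing, and $f_i:\mathbb{R}_{\geq 0}\to\mathbb{R}$ (cost of effort) is twice continuously differentiable and strictly increasing. Primes denote derivatives (one-sided at $0$). In the underlying model, sensor $i$ with effort $a_i$ reports $y_i=x+w_i$ with uncorrelated zero-mean noises $w_i$ of variance $\eta_i(a_i)$, is paid $p_i=\delta_i-\gamma_i(\hat{x}-y_i)^2$ with $\hat{x}=\frac1n\sum_{j=1}^n y_j$ and constants $\gamma_i,\delta_i\geq 0$, and maximizes $\alpha_i\mathbb{E}\{p_i\}-f_i(a_i)$ over $a_i\in\mathbb{R}_{\geq 0}$; $a_i^*(\gamma_i)$ is its effort at the contract (Nash) equilibrium of this game. *)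

theory Defs
  imports "HOL-Probability.Probability"
begin

text \<open>
  Derivatives on the half-line are taken \<open>within {0..}\<close>, hence are one-sided at \<open>0\<close>. They are determined
  by \<open>g\<close> there, so \<open>g'\<close> and \<open>g''\<close> only name the derivatives; their values at negative arguments are
  irrelevant.
\<close>

definition C2_nonneg :: "(real \<Rightarrow> real) \<Rightarrow> (real \<Rightarrow> real) \<Rightarrow> (real \<Rightarrow> real) \<Rightarrow> bool" where
  "C2_nonneg g g' g'' \<longleftrightarrow>
     (\<forall>a\<ge>0. (g has_real_derivative g' a) (at a within {0..})) \<and>
     (\<forall>a\<ge>0. (g' has_real_derivative g'' a) (at a within {0..})) \<and>
     continuous_on {0..} g''"

text \<open>
  The sensors are \<open>1, \<dots>, n\<close>. The random variable \<open>w i a\<close> is the noise of sensor \<open>i\<close> when it exerts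
  effort \<open>a\<close>. The measured quantity \<open>x\<close> may be random; a deterministic one is a constant function.
\<close>

locale sensor_game = prob_space M for M :: "'w measure" +
  fixes n :: nat
    and \<alpha> :: "nat \<Rightarrow> real"
    and \<eta> \<eta>' \<eta>'' :: "nat \<Rightarrow> real \<Rightarrow> real"
    and f f' f'' :: "nat \<Rightarrow> real \<Rightarrow> real"
    and x :: "'w \<Rightarrow> real"
    and w :: "nat \<Rightarrow> real \<Rightarrow> 'w \<Rightarrow> real"
  assumes \<alpha>_nonneg: "\<And>i. i \<in> {1..n} \<Longrightarrow> 0 \<le> \<alpha> i"
    and \<eta>_nonneg: "\<And>i a. i \<in> {1..n} \<Longrightarrow> 0 \<le> a \<Longrightarrow> 0 \<le> \<eta> i a"
    and \<eta>_C2: "\<And>i. i \<in> {1..n} \<Longrightarrow> C2_nonneg (\<eta> i) (\<eta>' i) (\<eta>'' i)"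
    and \<eta>_decreasing: "\<And>i. i \<in> {1..n} \<Longrightarrow> strict_antimono_on {0..} (\<eta> i)"
    and f_C2: "\<And>i. i \<in> {1..n} \<Longrightarrow> C2_nonneg (f i) (f' i) (f'' i)"
    and f_increasing: "\<And>i. i \<in> {1..n} \<Longrightarrow> strict_mono_on {0..} (f i)"
    and x_measurable: "random_variable borel x"
    and w_measurable: "\<And>i a. i \<in> {1..n} \<Longrightarrow> 0 \<le> a \<Longrightarrow> random_variable borel (w i a)"
    and w_square_integrable:
      "\<And>i a. i \<in> {1..n} \<Longrightarrow> 0 \<le> a \<Longrightarrow> integrable M (\<lambda>\<omega>. (w i a \<omega>)\<^sup>2)"
    and w_mean: "\<And>i a. i \<in> {1..n} \<Longrightarrow> 0 \<le> a \<Longrightarrow> expectation (w i a) = 0"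
    and w_variance: "\<And>i a. i \<in> {1..n} \<Longrightarrow> 0 \<le> a \<Longrightarrow> variance (w i a) = \<eta> i a"
    and w_uncorrelated:
      "\<And>i j a b. i \<in> {1..n} \<Longrightarrow> j \<in> {1..n} \<Longrightarrow> i \<noteq> j \<Longrightarrow> 0 \<le> a \<Longrightarrow> 0 \<le> b \<Longrightarrow>
         expectation (\<lambda>\<omega>. w i a \<omega> * w j b \<omega>) = 0"

definition report ::
  "('w \<Rightarrow> real) \<Rightarrow> (nat \<Rightarrow> real \<Rightarrow> 'w \<Rightarrow> real) \<Rightarrow> (nat \<Rightarrow> real) \<Rightarrow> nat \<Rightarrow> 'w \<Rightarrow> real" where
  "report x w a i \<omega> = x \<omega> + w i (a i) \<omega>"

definition estimate ::
  "nat \<Rightarrow> ('w \<Rightarrow> real) \<Rightarrow> (nat \<Rightarrow> real \<Rightarrow> 'w \<Rightarrow> real) \<Rightarrow> (nat \<Rightarrow> real) \<Rightarrow> 'w \<Rightarrow> real" where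
  "estimate n x w a \<omega> = (1 / real n) * (\<Sum>j=1..n. report x w a j \<omega>)"

definition payment ::
  "nat \<Rightarrow> ('w \<Rightarrow> real) \<Rightarrow> (nat \<Rightarrow> real \<Rightarrow> 'w \<Rightarrow> real) \<Rightarrow> (nat \<Rightarrow> real) \<Rightarrow> (nat \<Rightarrow> real) \<Rightarrow>
     (nat \<Rightarrow> real) \<Rightarrow> nat \<Rightarrow> 'w \<Rightarrow> real" where
  "payment n x w \<gamma> \<delta> a i \<omega> = \<delta> i - \<gamma> i * (estimate n x w a \<omega> - report x w a i \<omega>)\<^sup>2"

definition utility ::
  "'w measure \<Rightarrow> nat \<Rightarrow> (nat \<Rightarrow> real) \<Rightarrow> (nat \<Rightarrow> real \<Rightarrow> real) \<Rightarrow> ('w \<Rightarrow> real) \<Rightarrow>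
     (nat \<Rightarrow> real \<Rightarrow> 'w \<Rightarrow> real) \<Rightarrow> (nat \<Rightarrow> real) \<Rightarrow> (nat \<Rightarrow> real) \<Rightarrow> (nat \<Rightarrow> real) \<Rightarrow> nat \<Rightarrow> real" where
  "utility M n \<alpha> f x w \<gamma> \<delta> a i =
     \<alpha> i * integral\<^sup>L M (payment n x w \<gamma> \<delta> a i) - f i (a i)"

definition best_response ::
  "'w measure \<Rightarrow> nat \<Rightarrow> (nat \<Rightarrow> real) \<Rightarrow> (nat \<Rightarrow> real \<Rightarrow> real) \<Rightarrow> ('w \<Rightarrow> real) \<Rightarrow>
     (nat \<Rightarrow> real \<Rightarrow> 'w \<Rightarrow> real) \<Rightarrow> (nat \<Rightarrow> real) \<Rightarrow> (nat \<Rightarrow> real) \<Rightarrow> (nat \<Rightarrow> real) \<Rightarrow> nat \<Rightarrow> bool" where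
  "best_response M n \<alpha> f x w \<gamma> \<delta> a i \<longleftrightarrow>
     0 \<le> a i \<and>
     (\<forall>b\<ge>0. utility M n \<alpha> f x w \<gamma> \<delta> (a(i := b)) i \<le> utility M n \<alpha> f x w \<gamma> \<delta> a i)"

definition nash_equilibrium ::
  "'w measure \<Rightarrow> nat \<Rightarrow> (nat \<Rightarrow> real) \<Rightarrow> (nat \<Rightarrow> real \<Rightarrow> real) \<Rightarrow> ('w \<Rightarrow> real) \<Rightarrow>
     (nat \<Rightarrow> real \<Rightarrow> 'w \<Rightarrow> real) \<Rightarrow> (nat \<Rightarrow> real) \<Rightarrow> (nat \<Rightarrow> real) \<Rightarrow> (nat \<Rightarrow> real) \<Rightarrow> bool" where
  "nash_equilibrium M n \<alpha> f x w \<gamma> \<delta> a \<longleftrightarrow>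
     (\<forall>j\<in>{1..n}. best_response M n \<alpha> f x w \<gamma> \<delta> a j)"

text \<open>
  In the following definitions \<open>\<alpha>\<close>, \<open>\<eta>'\<close>, \<open>\<eta>''\<close>, \<open>f'\<close>, \<open>f''\<close> and \<open>g\<close> belong to a single sensor; \<open>g\<close> is
  its coefficient \<open>\<gamma>\<^sub>i\<close>.
\<close>

definition Gamma_set ::
  "nat \<Rightarrow> real \<Rightarrow> (real \<Rightarrow> real) \<Rightarrow> (real \<Rightarrow> real) \<Rightarrow> (real \<Rightarrow> real) \<Rightarrow> (real \<Rightarrow> real) \<Rightarrow> real set" where
  "Gamma_set n \<alpha> \<eta>' \<eta>'' f' f'' =
     {g. 0 \<le> g \<and>
         \<alpha> * g * ((real n - 1)\<^sup>2 / (real n)\<^sup>2) * \<eta>' 0 + f' 0 < 0 \<and>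
         (\<forall>a\<ge>0. \<alpha> * g * ((real n - 1)\<^sup>2 / (real n)\<^sup>2) * \<eta>'' a + f'' a > 0)}"

definition first_order_solution ::
  "nat \<Rightarrow> real \<Rightarrow> (real \<Rightarrow> real) \<Rightarrow> (real \<Rightarrow> real) \<Rightarrow> real \<Rightarrow> real \<Rightarrow> bool" where
  "first_order_solution n \<alpha> \<eta>' f' g a \<longleftrightarrow>
     0 \<le> a \<and> \<alpha> * g * ((real n - 1) / real n)\<^sup>2 * \<eta>' a + f' a = 0"

definition equilibrium_effort ::
  "nat \<Rightarrow> real \<Rightarrow> (real \<Rightarrow> real) \<Rightarrow> (real \<Rightarrow> real) \<Rightarrow> real \<Rightarrow> real" where
  "equilibrium_effort n \<alpha> \<eta>' f' g = (THE a. first_order_solution n \<alpha> \<eta>' f' g a)"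

end

theory Submission
  imports Defs
begin

text \<open>
  Effort affects the expected payment of sensor \<open>i\<close> only through the mean square of the difference
  between estimate and report. In this difference the measured quantity cancels and the
  uncorrelated noises enter with coefficient \<open>1/n\<close>, except that the own noise has coefficient
  \<open>1/n - 1\<close>. Hence, the efforts of the others being given, the utility of sensor \<open>i\<close> is a constant
  minus the objective \<open>\<phi> = k \<eta> + f\<close> with \<open>k = \<alpha> \<gamma> ((n - 1)/n)\<^sup>2\<close> (lemma \<open>utility_decomposition\<close>):
  the game decouples, and a best response is a minimiser of \<open>\<phi>\<close> on the half-line.

  On \<open>\<Gamma>\<close> the objective is strictly convex, initially decreasing, and it tends to infinity because
  \<open>\<eta> \<ge> 0\<close> and \<open>f\<close> does. Such a function has exactly one critical point, which is its unique minimiser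
  (lemmas \<open>convex_coercive_critical_point\<close> and \<open>convex_minimiser_iff_critical\<close>).

  For monotonicity, raising \<open>\<gamma>\<close> lowers \<open>\<phi>'\<close> at the old equilibrium effort, so that the zero of the
  increasing function \<open>\<phi>'\<close> moves to the right. This needs \<open>\<eta>' < 0\<close> at the equilibrium effort, whereas
  strict decrease of \<open>\<eta>\<close> only gives \<open>\<eta>' \<le> 0\<close>. If \<open>\<eta>'\<close> vanished there, then so would \<open>f'\<close>, which makes
  the point an interior maximum of \<open>\<eta>'\<close> and an interior minimum of \<open>f'\<close>; both second derivatives would
  then be zero, against the strict convexity of \<open>\<phi>\<close> (lemma \<open>deriv_neg_at_critical_point\<close>).
\<close>

section \<open>Differentiable functions on the half-line\<close>

lemma has_real_derivative_interior_nonneg: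
  fixes h :: "real \<Rightarrow> real"
  assumes "(h has_real_derivative d) (at t within {0..})" and "0 < t"
  shows "(h has_real_derivative d) (at t)"
  using assms by (simp add: at_within_interior[of t "{0..}"])

lemma increasing_if_deriv_pos_nonneg:
  fixes h h' :: "real \<Rightarrow> real"
  assumes deriv: "\<And>t. 0 \<le> t \<Longrightarrow> (h has_real_derivative h' t) (at t within {0..})"
    and "0 \<le> a" "a < b"
    and pos: "\<And>t. a < t \<Longrightarrow> t < b \<Longrightarrow> 0 < h' t"
  shows "h a < h b"
proof (rule DERIV_pos_imp_increasing_open[OF \<open>a < b\<close>])
  fix t assume t: "a < t" "t < b"
  then have "(h has_real_derivative h' t) (at t)"
    using deriv[of t] \<open>0 \<le> a\<close> by (intro has_real_derivative_interior_nonneg) simp_all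
  then show "\<exists>y. (h has_real_derivative y) (at t) \<and> 0 < y"
    using pos[OF t] by blast
next
  have "continuous_on {0..} h"
    using deriv by (intro DERIV_continuous_on[of _ _ h']) auto
  then show "continuous_on {a..b} h"
    by (rule continuous_on_subset) (use \<open>0 \<le> a\<close> in auto)
qed

lemma decreasing_if_deriv_neg_nonneg:
  fixes h h' :: "real \<Rightarrow> real"
  assumes deriv: "\<And>t. 0 \<le> t \<Longrightarrow> (h has_real_derivative h' t) (at t within {0..})"
    and "0 \<le> a" "a < b"
    and neg: "\<And>t. a < t \<Longrightarrow> t < b \<Longrightarrow> h' t < 0"
  shows "h b < h a"
proof -
  have "((\<lambda>t. - h t) has_real_derivative - h' t) (at t within {0..})" if "0 \<le> t" for t
    using deriv[OF that] by (rule DERIV_minus)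
  then have "- h a < - h b"
    by (rule increasing_if_deriv_pos_nonneg) (use assms(2,3) neg in simp_all)
  then show ?thesis
    by simp
qed

text \<open>
  All difference quotients are nonnegative. The argument runs within the half-line so that it covers
  the one-sided derivative at \<open>0\<close>, which is needed for \<open>f' 0 \<ge> 0\<close>.
\<close>

lemma mono_on_nonneg_imp_deriv_nonneg:
  fixes h :: "real \<Rightarrow> real"
  assumes mono: "mono_on {0..} h" and "0 \<le> t"
    and deriv: "(h has_real_derivative d) (at t within {0..})"
  shows "0 \<le> d"
proof (rule tendsto_lowerbound)
  show "((\<lambda>s. (h s - h t) / (s - t)) \<longlongrightarrow> d) (at t within {0..})"
    using deriv by (simp add: has_field_derivative_iff)
  show "\<forall>\<^sub>F s in at t within {0..}. 0 \<le> (h s - h t) / (s - t)"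
    unfolding eventually_at_filter
  proof (intro always_eventually allI impI)
    fix s assume "s \<noteq> t" "s \<in> {0..}"
    then show "0 \<le> (h s - h t) / (s - t)"
      using mono_onD[OF mono, of s t] mono_onD[OF mono, of t s] \<open>0 \<le> t\<close>
      by (cases "s < t") (auto simp: divide_nonpos_neg)
  qed
  have "at t within {t..} \<noteq> bot"
    by (metis at_within_Ici_at_right trivial_limit_at_right_real)
  then show "at t within {0..} \<noteq> bot"
    using at_le[of "{t..}" "{0..}" t] \<open>0 \<le> t\<close> by (auto simp: bot_unique)
qed

section \<open>Strictly convex objectives with a critical point\<close>

text \<open>
  Without a zero the continuous derivative would stay negative, and the function would be bounded by
  its value at \<open>0\<close> instead of tending to infinity.
\<close>

lemma convex_coercive_critical_point:
  fixes p p' p'' :: "real \<Rightarrow> real"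
  assumes p: "\<And>t. 0 \<le> t \<Longrightarrow> (p has_real_derivative p' t) (at t within {0..})"
    and p': "\<And>t. 0 \<le> t \<Longrightarrow> (p' has_real_derivative p'' t) (at t within {0..})"
    and convex: "\<And>t. 0 \<le> t \<Longrightarrow> 0 < p'' t"
    and init: "p' 0 < 0"
    and coercive: "filterlim p at_top at_top"
  shows "\<exists>!a. 0 \<le> a \<and> p' a = 0"
proof -
  have "\<exists>b>0. 0 \<le> p' b"
  proof (rule ccontr)
    assume "\<not> ?thesis"
    then have neg: "p' t < 0" if "0 < t" for t
      using that by force
    have "\<forall>\<^sub>F t in at_top. p 0 < p t \<and> 0 < t"
      using coercive eventually_gt_at_top[of "0::real"]
      by (auto simp: filterlim_at_top_dense intro: eventually_conj)
    then obtain t where "p 0 < p t" "0 < t"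
      using eventually_happens by fastforce
    then show False
      using decreasing_if_deriv_neg_nonneg[OF p, of 0 t] neg by auto
  qed
  then obtain b where "0 < b" "0 \<le> p' b"
    by blast
  moreover have "continuous_on {0..} p'"
    using p' by (intro DERIV_continuous_on[of _ _ p'']) auto
  then have "continuous_on {0..b} p'"
    by (rule continuous_on_subset) auto
  ultimately obtain a where a: "0 \<le> a \<and> p' a = 0"
    using IVT'[of p' 0 0 b] init by auto
  have incr: "p' s < p' t" if "0 \<le> s" "s < t" for s t
    using increasing_if_deriv_pos_nonneg[OF p' that] that convex by simp
  show ?thesis
  proof (intro ex1I[of _ a] a)
    fix b assume "0 \<le> b \<and> p' b = 0"
    then show "b = a"
      using incr[of a b] incr[of b a] a by (cases a b rule: linorder_cases) auto
  qed
qed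

text \<open>
  As the derivative increases through its zero, the function falls strictly before that point and
  rises strictly after it.
\<close>

lemma convex_minimiser_iff_critical:
  fixes p p' p'' :: "real \<Rightarrow> real"
  assumes p: "\<And>t. 0 \<le> t \<Longrightarrow> (p has_real_derivative p' t) (at t within {0..})"
    and p': "\<And>t. 0 \<le> t \<Longrightarrow> (p' has_real_derivative p'' t) (at t within {0..})"
    and convex: "\<And>t. 0 \<le> t \<Longrightarrow> 0 < p'' t"
    and crit: "0 \<le> c" "p' c = 0"
    and "0 \<le> a"
  shows "(\<forall>b\<ge>0. p a \<le> p b) \<longleftrightarrow> a = c"
proof -
  have incr: "p' s < p' t" if "0 \<le> s" "s < t" for s t
    using increasing_if_deriv_pos_nonneg[OF p' that] that convex by simp
  have less: "p c < p b" if "0 \<le> b" "b \<noteq> c" for b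
  proof (cases "b < c")
    case True
    then show ?thesis
      using decreasing_if_deriv_neg_nonneg[OF p, of b c] incr[of _ c] crit that by auto
  next
    case False
    then show ?thesis
      using increasing_if_deriv_pos_nonneg[OF p, of c b] incr[of c] crit that by auto
  qed
  show ?thesis
  proof
    assume "\<forall>b\<ge>0. p a \<le> p b"
    then have "p a \<le> p c"
      using crit by simp
    then show "a = c"
      using less[OF \<open>0 \<le> a\<close>] by auto
  next
    assume "a = c"
    then show "\<forall>b\<ge>0. p a \<le> p b"
      using less by (metis order_le_less)
  qed
qed

text \<open>
  A vanishing first term would force both derivatives to have an extremal value at the critical point,
  hence both second derivatives to vanish there. The critical point has to be interior for this, since
  at \<open>0\<close> a maximum of \<open>u'\<close> only bounds the sign of \<open>u''\<close>.
\<close>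

lemma deriv_neg_at_critical_point:
  fixes u' u'' v' v'' :: "real \<Rightarrow> real"
  assumes u': "\<And>t. 0 \<le> t \<Longrightarrow> (u' has_real_derivative u'' t) (at t within {0..})"
    and v': "\<And>t. 0 \<le> t \<Longrightarrow> (v' has_real_derivative v'' t) (at t within {0..})"
    and u'_nonpos: "\<And>t. 0 \<le> t \<Longrightarrow> u' t \<le> 0"
    and v'_nonneg: "\<And>t. 0 \<le> t \<Longrightarrow> 0 \<le> v' t"
    and "0 < a" and crit: "k * u' a + v' a = 0" and convex: "0 < k * u'' a + v'' a"
  shows "u' a < 0"
proof (rule ccontr)
  assume "\<not> u' a < 0"
  then have zero: "u' a = 0" "v' a = 0"
    using u'_nonpos[of a] crit \<open>0 < a\<close> by auto
  have near: "0 \<le> t" if "\<bar>a - t\<bar> < a" for t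
    using that by auto
  have "u'' a = 0"
    by (rule DERIV_local_max[of u' _ a a])
      (use has_real_derivative_interior_nonneg[OF u'] \<open>0 < a\<close> zero u'_nonpos near in auto)
  moreover have "v'' a = 0"
    by (rule DERIV_local_min[of v' _ a a])
      (use has_real_derivative_interior_nonneg[OF v'] \<open>0 < a\<close> zero v'_nonneg near in auto)
  ultimately show False
    using convex by simp
qed

section \<open>Expected payment under uncorrelated noise\<close>

lemma integrable_mult_of_square_integrable:
  fixes X Y :: "'a \<Rightarrow> real"
  assumes [measurable]: "X \<in> borel_measurable M" "Y \<in> borel_measurable M"
    and "integrable M (\<lambda>\<omega>. (X \<omega>)\<^sup>2)" "integrable M (\<lambda>\<omega>. (Y \<omega>)\<^sup>2)"
  shows "integrable M (\<lambda>\<omega>. X \<omega> * Y \<omega>)"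
proof (rule Bochner_Integration.integrable_bound)
  show "integrable M (\<lambda>\<omega>. (X \<omega>)\<^sup>2 + (Y \<omega>)\<^sup>2)"
    using assms by simp
  have "\<bar>r * s\<bar> \<le> r\<^sup>2 + s\<^sup>2" for r s :: real
  proof -
    have "0 \<le> \<bar>r\<bar> * \<bar>s\<bar>"
      by simp
    moreover have "2 * (\<bar>r\<bar> * \<bar>s\<bar>) \<le> r\<^sup>2 + s\<^sup>2"
      using sum_squares_bound[of "\<bar>r\<bar>" "\<bar>s\<bar>"] by (simp add: mult.assoc)
    ultimately show ?thesis
      unfolding abs_mult by linarith
  qed
  then show "AE \<omega> in M. norm (X \<omega> * Y \<omega>) \<le> norm ((X \<omega>)\<^sup>2 + (Y \<omega>)\<^sup>2)"
    by (intro AE_I2) simp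
qed simp

lemma has_bochner_integral_square_sum_uncorrelated:
  fixes X :: "'i \<Rightarrow> 'a \<Rightarrow> real"
  assumes "finite J"
    and meas: "\<And>j. j \<in> J \<Longrightarrow> X j \<in> borel_measurable M"
    and square: "\<And>j. j \<in> J \<Longrightarrow> integrable M (\<lambda>\<omega>. (X j \<omega>)\<^sup>2)"
    and uncorr: "\<And>j k. j \<in> J \<Longrightarrow> k \<in> J \<Longrightarrow> j \<noteq> k \<Longrightarrow> (\<integral>\<omega>. X j \<omega> * X k \<omega> \<partial>M) = 0"
  shows "has_bochner_integral M (\<lambda>\<omega>. (\<Sum>j\<in>J. X j \<omega>)\<^sup>2) (\<Sum>j\<in>J. \<integral>\<omega>. (X j \<omega>)\<^sup>2 \<partial>M)"
proof -
  have "has_bochner_integral M (\<lambda>\<omega>. \<Sum>j\<in>J. \<Sum>k\<in>J. X j \<omega> * X k \<omega>)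
      (\<Sum>j\<in>J. \<Sum>k\<in>J. \<integral>\<omega>. X j \<omega> * X k \<omega> \<partial>M)"
    by (intro has_bochner_integral_sum has_bochner_integral_integrable
        integrable_mult_of_square_integrable meas square)
  moreover have "(\<Sum>k\<in>J. \<integral>\<omega>. X j \<omega> * X k \<omega> \<partial>M) = (\<integral>\<omega>. (X j \<omega>)\<^sup>2 \<partial>M)" if "j \<in> J" for j
  proof -
    have "(\<Sum>k\<in>J. \<integral>\<omega>. X j \<omega> * X k \<omega> \<partial>M)
        = (\<Sum>k\<in>J. if k = j then \<integral>\<omega>. (X j \<omega>)\<^sup>2 \<partial>M else 0)"
      by (intro sum.cong) (auto simp: power2_eq_square uncorr that)
    then show ?thesis
      using \<open>finite J\<close> that by simp
  qed
  ultimately show ?thesis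
    by (simp add: power2_eq_square sum_product)
qed

lemma Gamma_setD:
  assumes "g \<in> Gamma_set n \<alpha> \<eta>' \<eta>'' f' f''"
  shows "\<alpha> * g * ((real n - 1) / real n)\<^sup>2 * \<eta>' 0 + f' 0 < 0"
    and "0 \<le> t \<Longrightarrow> 0 < \<alpha> * g * ((real n - 1) / real n)\<^sup>2 * \<eta>'' t + f'' t"
  using assms unfolding Gamma_set_def power_divide by blast+

context sensor_game
begin

lemma estimate_minus_report:
  assumes "i \<in> {1..n}"
  shows "estimate n x w a \<omega> - report x w a i \<omega>
    = (\<Sum>j=1..n. (1 / real n - (if j = i then 1 else 0)) * w j (a j) \<omega>)"
proof -
  have "n > 0"
    using assms by simp
  have "(\<Sum>j=1..n. (1 / real n - (if j = i then 1 else 0)) * w j (a j) \<omega>)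
    = (\<Sum>j=1..n. 1 / real n * w j (a j) \<omega> - (if j = i then w j (a j) \<omega> else 0))"
    by (intro sum.cong) (auto simp: algebra_simps)
  also have "\<dots> = 1 / real n * (\<Sum>j=1..n. w j (a j) \<omega>) - w i (a i) \<omega>"
    using assms by (simp add: sum_subtractf sum_divide_distrib)
  finally show ?thesis
    using \<open>n > 0\<close> by (simp add: estimate_def report_def sum.distrib field_simps)
qed

lemma has_bochner_integral_estimate_minus_report:
  assumes i: "i \<in> {1..n}" and a: "\<And>j. j \<in> {1..n} \<Longrightarrow> 0 \<le> a j"
  shows "has_bochner_integral M (\<lambda>\<omega>. (estimate n x w a \<omega> - report x w a i \<omega>)\<^sup>2)
    ((\<Sum>j\<in>{1..n} - {i}. \<eta> j (a j)) / (real n)\<^sup>2 + ((real n - 1) / real n)\<^sup>2 * \<eta> i (a i))"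
proof -
  define c where "c j = 1 / real n - (if j = i then 1 else 0)" for j
  have second_moment: "expectation (\<lambda>\<omega>. (w j (a j) \<omega>)\<^sup>2) = \<eta> j (a j)" if "j \<in> {1..n}" for j
    using w_mean[OF that a[OF that]] w_variance[OF that a[OF that]] by simp
  have "has_bochner_integral M (\<lambda>\<omega>. (\<Sum>j=1..n. c j * w j (a j) \<omega>)\<^sup>2)
      (\<Sum>j=1..n. expectation (\<lambda>\<omega>. (c j * w j (a j) \<omega>)\<^sup>2))"
  proof (rule has_bochner_integral_square_sum_uncorrelated)
    fix j assume j: "j \<in> {1..n}"
    show "random_variable borel (\<lambda>\<omega>. c j * w j (a j) \<omega>)"
      using w_measurable[OF j a[OF j]] by simp
    show "integrable M (\<lambda>\<omega>. (c j * w j (a j) \<omega>)\<^sup>2)"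
      using w_square_integrable[OF j a[OF j]] by (simp add: power_mult_distrib)
    fix k assume k: "k \<in> {1..n}" "j \<noteq> k"
    have "(\<lambda>\<omega>. c j * w j (a j) \<omega> * (c k * w k (a k) \<omega>))
        = (\<lambda>\<omega>. (c j * c k) * (w j (a j) \<omega> * w k (a k) \<omega>))"
      by (auto simp: algebra_simps)
    then show "expectation (\<lambda>\<omega>. c j * w j (a j) \<omega> * (c k * w k (a k) \<omega>)) = 0"
      using w_uncorrelated[OF j k a[OF j] a[OF k(1)]] by simp
  qed simp
  also have "(\<Sum>j=1..n. expectation (\<lambda>\<omega>. (c j * w j (a j) \<omega>)\<^sup>2)) = (\<Sum>j=1..n. (c j)\<^sup>2 * \<eta> j (a j))"
    by (intro sum.cong) (auto simp: power_mult_distrib second_moment)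
  also have "\<dots> = (c i)\<^sup>2 * \<eta> i (a i) + (\<Sum>j\<in>{1..n} - {i}. (c j)\<^sup>2 * \<eta> j (a j))"
    using i by (simp add: sum.remove)
  also have "(\<Sum>j\<in>{1..n} - {i}. (c j)\<^sup>2 * \<eta> j (a j)) = (\<Sum>j\<in>{1..n} - {i}. \<eta> j (a j)) / (real n)\<^sup>2"
    unfolding sum_divide_distrib by (intro sum.cong) (auto simp: c_def power_divide)
  also have "(c i)\<^sup>2 = ((real n - 1) / real n)\<^sup>2"
    using i by (simp add: c_def field_simps power2_eq_square)
  finally show ?thesis
    unfolding estimate_minus_report[OF i] c_def by (simp add: add.commute)
qed

text \<open>
  The efforts of the other sensors enter additively, through a constant that sensor \<open>i\<close> cannot
  influence.
\<close>

lemma utility_decomposition: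
  assumes i: "i \<in> {1..n}" and a: "\<And>j. j \<in> {1..n} \<Longrightarrow> 0 \<le> a j"
  shows "utility M n \<alpha> f x w \<gamma> \<delta> a i =
    \<alpha> i * (\<delta> i - \<gamma> i * ((\<Sum>j\<in>{1..n} - {i}. \<eta> j (a j)) / (real n)\<^sup>2))
    - (\<alpha> i * \<gamma> i * ((real n - 1) / real n)\<^sup>2 * \<eta> i (a i) + f i (a i))"
proof -
  note sq = has_bochner_integral_estimate_minus_report[of i a, OF i a]
  have "expectation (payment n x w \<gamma> \<delta> a i)
    = \<delta> i - \<gamma> i * expectation (\<lambda>\<omega>. (estimate n x w a \<omega> - report x w a i \<omega>)\<^sup>2)"
    using has_bochner_integral_iff[THEN iffD1, OF sq]
    by (simp add: payment_def[abs_def] prob_space)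
  also have "expectation (\<lambda>\<omega>. (estimate n x w a \<omega> - report x w a i \<omega>)\<^sup>2)
    = (\<Sum>j\<in>{1..n} - {i}. \<eta> j (a j)) / (real n)\<^sup>2 + ((real n - 1) / real n)\<^sup>2 * \<eta> i (a i)"
    by (rule has_bochner_integral_integral_eq[OF sq])
  finally show ?thesis
    unfolding utility_def by (simp only:) (simp only: algebra_simps)
qed

lemma best_response_iff_minimiser:
  assumes i: "i \<in> {1..n}" and a: "\<And>j. j \<in> {1..n} \<Longrightarrow> 0 \<le> a j"
  shows "best_response M n \<alpha> f x w \<gamma> \<delta> a i \<longleftrightarrow>
    (\<forall>b\<ge>0. \<alpha> i * \<gamma> i * ((real n - 1) / real n)\<^sup>2 * \<eta> i (a i) + f i (a i)
      \<le> \<alpha> i * \<gamma> i * ((real n - 1) / real n)\<^sup>2 * \<eta> i b + f i b)"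
proof -
  define C where "C = \<alpha> i * (\<delta> i - \<gamma> i * ((\<Sum>j\<in>{1..n} - {i}. \<eta> j (a j)) / (real n)\<^sup>2))"
  have "utility M n \<alpha> f x w \<gamma> \<delta> (a(i := b)) i =
    C - (\<alpha> i * \<gamma> i * ((real n - 1) / real n)\<^sup>2 * \<eta> i b + f i b)" if "0 \<le> b" for b
  proof -
    have "(\<Sum>j\<in>{1..n} - {i}. \<eta> j ((a(i := b)) j)) = (\<Sum>j\<in>{1..n} - {i}. \<eta> j (a j))"
      by (intro sum.cong) auto
    then show ?thesis
      using utility_decomposition[OF i, of "a(i := b)"] a that by (simp add: C_def)
  qed
  moreover have "utility M n \<alpha> f x w \<gamma> \<delta> a i =
    C - (\<alpha> i * \<gamma> i * ((real n - 1) / real n)\<^sup>2 * \<eta> i (a i) + f i (a i))"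
    unfolding C_def by (rule utility_decomposition[OF i a])
  ultimately show ?thesis
    unfolding best_response_def using a[OF i] by (auto simp del: times_divide_eq_right)
qed

section \<open>Equilibrium effort\<close>

lemma objective_has_derivative:
  assumes "i \<in> {1..n}" "0 \<le> t"
  shows "((\<lambda>t. k * \<eta> i t + f i t) has_real_derivative k * \<eta>' i t + f' i t) (at t within {0..})"
    and "((\<lambda>t. k * \<eta>' i t + f' i t) has_real_derivative k * \<eta>'' i t + f'' i t) (at t within {0..})"
  using \<eta>_C2[OF assms(1)] f_C2[OF assms(1)] \<open>0 \<le> t\<close>
  unfolding C2_nonneg_def by (auto intro!: derivative_eq_intros)

lemma \<eta>'_nonpos:
  assumes "i \<in> {1..n}" "0 \<le> t"
  shows "\<eta>' i t \<le> 0"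
proof -
  have "mono_on {0..} (\<lambda>t. - \<eta> i t)"
    using \<eta>_decreasing[OF assms(1)] by (auto simp: monotone_on_def order_le_less)
  moreover have "((\<lambda>t. - \<eta> i t) has_real_derivative - \<eta>' i t) (at t within {0..})"
    using \<eta>_C2[OF assms(1)] \<open>0 \<le> t\<close> unfolding C2_nonneg_def by (auto intro!: derivative_eq_intros)
  ultimately show ?thesis
    using mono_on_nonneg_imp_deriv_nonneg[of "\<lambda>t. - \<eta> i t" t] \<open>0 \<le> t\<close> by fastforce
qed

lemma f'_nonneg:
  assumes "i \<in> {1..n}" "0 \<le> t"
  shows "0 \<le> f' i t"
  using mono_on_nonneg_imp_deriv_nonneg[OF strict_mono_on_imp_mono_on[OF f_increasing[OF assms(1)]]]
    f_C2[OF assms(1)] \<open>0 \<le> t\<close> unfolding C2_nonneg_def by blast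

lemma ex1_first_order_solution:
  assumes i: "i \<in> {1..n}" and coercive: "filterlim (f i) at_top at_top"
    and g: "g \<in> Gamma_set n (\<alpha> i) (\<eta>' i) (\<eta>'' i) (f' i) (f'' i)"
  shows "\<exists>!a. first_order_solution n (\<alpha> i) (\<eta>' i) (f' i) g a"
proof -
  define k where "k = \<alpha> i * g * ((real n - 1) / real n)\<^sup>2"
  have "0 \<le> k"
    using g \<alpha>_nonneg[OF i] by (simp add: k_def Gamma_set_def)
  have "filterlim (\<lambda>t. k * \<eta> i t + f i t) at_top at_top"
    by (rule filterlim_at_top_mono[OF coercive eventually_mono[OF eventually_ge_at_top[of 0]]])
      (use \<eta>_nonneg[OF i] \<open>0 \<le> k\<close> in simp)
  then have "\<exists>!a. 0 \<le> a \<and> k * \<eta>' i a + f' i a = 0"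
    using objective_has_derivative[OF i] Gamma_setD[OF g, folded k_def]
    by (intro convex_coercive_critical_point[where p = "\<lambda>t. k * \<eta> i t + f i t"
          and p' = "\<lambda>t. k * \<eta>' i t + f' i t" and p'' = "\<lambda>t. k * \<eta>'' i t + f'' i t"])
  then show ?thesis
    by (simp add: first_order_solution_def k_def)
qed

lemma first_order_solution_equilibrium_effort:
  assumes "i \<in> {1..n}" "filterlim (f i) at_top at_top"
    and "g \<in> Gamma_set n (\<alpha> i) (\<eta>' i) (\<eta>'' i) (f' i) (f'' i)"
  shows "first_order_solution n (\<alpha> i) (\<eta>' i) (f' i) g (equilibrium_effort n (\<alpha> i) (\<eta>' i) (f' i) g)"
  unfolding equilibrium_effort_def by (rule theI'[OF ex1_first_order_solution[OF assms]])

lemma best_response_iff_equilibrium_effort: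
  assumes i: "i \<in> {1..n}" and coercive: "filterlim (f i) at_top at_top"
    and a: "\<And>j. j \<in> {1..n} \<Longrightarrow> 0 \<le> a j"
    and g: "\<gamma> i \<in> Gamma_set n (\<alpha> i) (\<eta>' i) (\<eta>'' i) (f' i) (f'' i)"
  shows "best_response M n \<alpha> f x w \<gamma> \<delta> a i \<longleftrightarrow>
    a i = equilibrium_effort n (\<alpha> i) (\<eta>' i) (f' i) (\<gamma> i)"
proof -
  define k where "k = \<alpha> i * \<gamma> i * ((real n - 1) / real n)\<^sup>2"
  define e where "e = equilibrium_effort n (\<alpha> i) (\<eta>' i) (f' i) (\<gamma> i)"
  have "0 \<le> e" "k * \<eta>' i e + f' i e = 0"
    using first_order_solution_equilibrium_effort[OF i coercive g]
    by (simp_all add: first_order_solution_def k_def e_def)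
  then have "(\<forall>b\<ge>0. k * \<eta> i (a i) + f i (a i) \<le> k * \<eta> i b + f i b) \<longleftrightarrow> a i = e"
    using objective_has_derivative[OF i] Gamma_setD(2)[OF g, folded k_def] a[OF i]
    by (intro convex_minimiser_iff_critical[where p = "\<lambda>t. k * \<eta> i t + f i t"
          and p' = "\<lambda>t. k * \<eta>' i t + f' i t" and p'' = "\<lambda>t. k * \<eta>'' i t + f'' i t"])
  then show ?thesis
    using best_response_iff_minimiser[of i a \<gamma> \<delta>, OF i a] by (simp add: k_def e_def)
qed

lemma strict_mono_on_equilibrium_effort:
  assumes i: "i \<in> {1..n}" and coercive: "filterlim (f i) at_top at_top"
  shows "strict_mono_on (Gamma_set n (\<alpha> i) (\<eta>' i) (\<eta>'' i) (f' i) (f'' i))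
    (equilibrium_effort n (\<alpha> i) (\<eta>' i) (f' i))"
proof (rule strict_mono_onI)
  let ?\<Gamma> = "Gamma_set n (\<alpha> i) (\<eta>' i) (\<eta>'' i) (f' i) (f'' i)"
    and ?e = "equilibrium_effort n (\<alpha> i) (\<eta>' i) (f' i)"
  fix g h assume g: "g \<in> ?\<Gamma>" and h: "h \<in> ?\<Gamma>" and "g < h"
  define c where "c = \<alpha> i * ((real n - 1) / real n)\<^sup>2"
  have \<Gamma>_D: "(c * r) * \<eta>' i 0 + f' i 0 < 0" "0 \<le> t \<Longrightarrow> 0 < (c * r) * \<eta>'' i t + f'' i t"
    if "r \<in> ?\<Gamma>" for r t
    using Gamma_setD[OF that] by (simp_all add: c_def mult_ac)
  have e_D: "0 \<le> ?e r" "(c * r) * \<eta>' i (?e r) + f' i (?e r) = 0" if "r \<in> ?\<Gamma>" for r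
    using first_order_solution_equilibrium_effort[OF i coercive that]
    by (auto simp: first_order_solution_def c_def mult_ac)
  have "0 \<le> c"
    using \<alpha>_nonneg[OF i] by (simp add: c_def)
  \<comment> \<open>With \<open>c = 0\<close> the condition at \<open>0\<close> defining \<open>\<Gamma>\<close> would read \<open>f' 0 < 0\<close>.\<close>
  moreover have "c \<noteq> 0"
    using \<Gamma>_D(1)[OF g] f'_nonneg[OF i, of 0] by auto
  ultimately have "0 < c"
    by simp
  have "?e g \<noteq> 0"
    using \<Gamma>_D(1)[OF g] e_D(2)[OF g] by auto
  then have "0 < ?e g"
    using e_D(1)[OF g] by simp
  have "\<eta>' i (?e g) < 0"
    using \<eta>_C2[OF i] f_C2[OF i] \<open>0 < ?e g\<close> e_D[OF g] \<Gamma>_D(2)[OF g e_D(1)[OF g]]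
    by (intro deriv_neg_at_critical_point[where u' = "\<eta>' i" and u'' = "\<eta>'' i"
          and v' = "f' i" and v'' = "f'' i" and k = "c * g"])
      (auto simp: C2_nonneg_def \<eta>'_nonpos[OF i] f'_nonneg[OF i])
  then have "c * h * \<eta>' i (?e g) < c * g * \<eta>' i (?e g)"
    using \<open>0 < c\<close> \<open>g < h\<close> by simp
  then have "c * h * \<eta>' i (?e g) + f' i (?e g) < 0"
    using e_D(2)[OF g] by simp
  \<comment> \<open>The derivative of the objective for \<open>h\<close> increases, so its zero lies to the right.\<close>
  show "?e g < ?e h"
  proof (rule ccontr)
    assume "\<not> ?e g < ?e h"
    moreover have "?e g \<noteq> ?e h"
      using \<open>c * h * \<eta>' i (?e g) + f' i (?e g) < 0\<close> e_D(2)[OF h] by auto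
    ultimately have "?e h < ?e g"
      by simp
    then have "c * h * \<eta>' i (?e h) + f' i (?e h) < c * h * \<eta>' i (?e g) + f' i (?e g)"
      using increasing_if_deriv_pos_nonneg[OF objective_has_derivative(2)[OF i] e_D(1)[OF h], of "?e g" "c * h"]
        \<Gamma>_D(2)[OF h] e_D(1)[OF h] by simp
    then show False
      using \<open>c * h * \<eta>' i (?e g) + f' i (?e g) < 0\<close> e_D(2)[OF h] by simp
  qed
qed

end

theorem proposition4:
  fixes M :: "'w measure" and n i :: nat
    and \<alpha> :: "nat \<Rightarrow> real"
    and \<eta> \<eta>' \<eta>'' f f' f'' :: "nat \<Rightarrow> real \<Rightarrow> real"
    and x :: "'w \<Rightarrow> real" and w :: "nat \<Rightarrow> real \<Rightarrow> 'w \<Rightarrow> real"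
  assumes "sensor_game M n \<alpha> \<eta> \<eta>' \<eta>'' f f' f'' x w"
    and "i \<in> {1..n}"
    and "filterlim (f i) at_top at_top"
  shows "let \<Gamma> = Gamma_set n (\<alpha> i) (\<eta>' i) (\<eta>'' i) (f' i) (f'' i);
             a_star = equilibrium_effort n (\<alpha> i) (\<eta>' i) (f' i)
         in (\<forall>g\<in>\<Gamma>. \<exists>!a. first_order_solution n (\<alpha> i) (\<eta>' i) (f' i) g a) \<and>
            (\<forall>\<gamma> \<delta> a. (\<forall>j\<in>{1..n}. 0 \<le> \<gamma> j \<and> 0 \<le> \<delta> j \<and> 0 \<le> a j) \<and> \<gamma> i \<in> \<Gamma> \<longrightarrow>
               (best_response M n \<alpha> f x w \<gamma> \<delta> a i \<longleftrightarrow> a i = a_star (\<gamma> i))) \<and>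
            (\<forall>\<gamma> \<delta> a. (\<forall>j\<in>{1..n}. 0 \<le> \<gamma> j \<and> 0 \<le> \<delta> j) \<and> \<gamma> i \<in> \<Gamma> \<and>
               nash_equilibrium M n \<alpha> f x w \<gamma> \<delta> a \<longrightarrow> a i = a_star (\<gamma> i)) \<and>
            strict_mono_on \<Gamma> a_star"
proof -
  interpret sensor_game M n \<alpha> \<eta> \<eta>' \<eta>'' f f' f'' x w
    by fact
  let ?\<Gamma> = "Gamma_set n (\<alpha> i) (\<eta>' i) (\<eta>'' i) (f' i) (f'' i)"
    and ?e = "equilibrium_effort n (\<alpha> i) (\<eta>' i) (f' i)"
  note best = best_response_iff_equilibrium_effort[OF assms(2,3)]
  have "a i = ?e (\<gamma> i)"
    if "nash_equilibrium M n \<alpha> f x w \<gamma> \<delta> a" "\<gamma> i \<in> ?\<Gamma>" for \<gamma> \<delta> a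
    using that best[of a \<gamma> \<delta>] assms(2) by (auto simp: nash_equilibrium_def best_response_def)
  then show ?thesis
    using ex1_first_order_solution[OF assms(2,3)] best strict_mono_on_equilibrium_effort[OF assms(2,3)]
    unfolding Let_def by blast
qed

end
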